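(* Let $G$ be a finite simple graph. If the independence attractor $\mathcal{A}(G)$ is a line segment $J$, then $J=[-\frac{4}{k},0]\subset\mathbb{R}$ for some $k\in\{1,2,3,4\}$.
   Context: For a finite simple graph $G$, an independent set is a set of pairwise non-adjacent vertices. The independence polynomial is $I_G(z)=\sum_{i=0}^{\alpha} a_i z^i$, where $a_i$ is the number of independent sets of cardinality $i$ (so $a_0=1$) and $\alpha$ (the independence number) is the largest cardinality of an independent set. The lexicographic product $G[H]$ has vertex set $V(G)\times V(H)$, with $(u,v)\sim(u',v')$ iff $u\sim u'$ in $G$, or $u=u'$ and $v\sim v'$ in $H$. Let $G^m$ denote the $m$-fold lexicographic product of $G$ with itself. The independence attractor is $\mathcal{A}(G)=\lim_{m\to\infty}\{z\in\mathbb{C}: I_{G^m}(z)=0\}$, the limit taken in the Hausdorff metric on nonempty compact subsets of $\mathbb{C}$. *)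

theory Defs
  imports "HOL-Analysis.Analysis"
begin

definition simple_graph :: "'a set \<Rightarrow> ('a \<Rightarrow> 'a \<Rightarrow> bool) \<Rightarrow> bool" where
  "simple_graph V E \<longleftrightarrow> finite V \<and> (\<forall>x y. E x y \<longrightarrow> E y x) \<and> (\<forall>x. \<not> E x x)
      \<and> (\<forall>x y. E x y \<longrightarrow> x \<in> V \<and> y \<in> V)"

definition independent_set :: "'a set \<Rightarrow> ('a \<Rightarrow> 'a \<Rightarrow> bool) \<Rightarrow> 'a set \<Rightarrow> bool" where
  "independent_set V E S \<longleftrightarrow> S \<subseteq> V \<and> (\<forall>x\<in>S. \<forall>y\<in>S. \<not> E x y)"

definition indep_poly :: "'a set \<Rightarrow> ('a \<Rightarrow> 'a \<Rightarrow> bool) \<Rightarrow> complex \<Rightarrow> complex" where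
  "indep_poly V E z = (\<Sum>S\<in>{S. independent_set V E S}. z ^ card S)"

definition lex_prod_edge ::
  "('a \<Rightarrow> 'a \<Rightarrow> bool) \<Rightarrow> ('b \<Rightarrow> 'b \<Rightarrow> bool) \<Rightarrow> 'a \<times> 'b \<Rightarrow> 'a \<times> 'b \<Rightarrow> bool" where
  "lex_prod_edge E F p q \<longleftrightarrow> E (fst p) (fst q) \<or> (fst p = fst q \<and> F (snd p) (snd q))"

(* m-fold lexicographic power G^m = G[G^(m-1)], G^0 = single vertex,
   with vertices represented as lists of length m over V: the vertex
   (x, w) of G[G^(m-1)] is encoded as the list x # w; the recursive clause is
   exactly lex_prod_edge E (lexpow_edge E) (x, xs) (y, ys), unfolded. *)
fun lexpow_edge :: "('a \<Rightarrow> 'a \<Rightarrow> bool) \<Rightarrow> 'a list \<Rightarrow> 'a list \<Rightarrow> bool" where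
  "lexpow_edge E (x # xs) (y # ys) =
     (E x y \<or> (x = y \<and> lexpow_edge E xs ys))"
| "lexpow_edge E _ _ = False"

definition lexpow_verts :: "'a set \<Rightarrow> nat \<Rightarrow> 'a list set" where
  "lexpow_verts V m = {xs. length xs = m \<and> set xs \<subseteq> V}"

definition lexpow_roots :: "'a set \<Rightarrow> ('a \<Rightarrow> 'a \<Rightarrow> bool) \<Rightarrow> nat \<Rightarrow> complex set" where
  "lexpow_roots V E m = {z. indep_poly (lexpow_verts V m) (lexpow_edge E) z = 0}"

definition hausdorff_dist :: "'a::metric_space set \<Rightarrow> 'a set \<Rightarrow> real" where
  "hausdorff_dist S T = max (SUP x\<in>S. infdist x T) (SUP y\<in>T. infdist y S)"

definition independence_attractor ::
  "'a set \<Rightarrow> ('a \<Rightarrow> 'a \<Rightarrow> bool) \<Rightarrow> complex set \<Rightarrow> bool" where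
  "independence_attractor V E A \<longleftrightarrow>
     A \<noteq> {} \<and> compact A \<and>
     (\<forall>\<^sub>F m in sequentially. lexpow_roots V E m \<noteq> {}) \<and>
     ((\<lambda>m. hausdorff_dist (lexpow_roots V E m) A) \<longlonglongrightarrow> 0)"

end

theory Submission
  imports
    Defs
    "HOL-Combinatorics.Multiset_Permutations"
    "HOL-Computational_Algebra.Fundamental_Theorem_Algebra"
begin

text \<open>
  Put \<open>f = I\<^sub>G - 1\<close>, so that the roots of \<open>I\<close> of the \<open>m\<close>-th power of \<open>G\<close> are the solutions of
  \<open>f\<^sup>m(z) = - 1\<close>. Each of these root sets is the \<open>f\<close>-preimage of the preceding one, hence their limit
  \<open>J\<close> satisfies \<open>f\<^sup>-\<^sup>1(J) = J\<close>. For a segment \<open>J\<close> with endpoints \<open>a\<close> and \<open>b\<close>, a point of the open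
  segment that is mapped to an endpoint is critical; comparing orders of roots and then degrees gives
  the Chebyshev equation \<open>d\<^sup>2 (f - a) (f - b) = (z - a) (z - b) f'\<^sup>2\<close> with \<open>d = degree f\<close>.

  At \<open>z = 0\<close> it says \<open>d\<^sup>2 a b = n\<^sup>2 a b\<close>, where \<open>n\<close> is the number of vertices. If \<open>d = n\<close>, then \<open>G\<close> has
  no edges and all the root sets are \<open>{- 1}\<close>, so one endpoint is \<open>0\<close>. Writing \<open>- 4 / k\<close> for the other
  one, the equation determines all coefficients of \<open>f\<close>: those of \<open>z\<close>, \<open>z\<^sup>2\<close>, \<open>z\<^sup>3\<close> and \<open>z\<^sup>d\<close> are
  \<open>n = d\<^sup>2\<close>, \<open>k n (n - 1) / 12\<close>, \<open>k\<^sup>2 n (n - 1) (n - 4) / 360\<close> and \<open>k\<^bsup>d - 1\<^esup>\<close>. The second and the last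
  one are integers, so \<open>k\<close> is rational and an algebraic integer, hence an integer. Goodman's bound on
  the number of triangles of the complement, applied to the second and third one, gives
  \<open>n (30 - 7 k) \<ge> 2 k\<close>, hence \<open>k \<le> 4\<close>.
\<close>

subsection \<open>Independent sets of lexicographic powers\<close>

lemma finite_independent_sets: "finite V \<Longrightarrow> finite {S. independent_set V E S}"
  by (rule finite_subset[of _ "Pow V"]) (auto simp: independent_set_def)

lemma finite_lexpow_verts: "finite V \<Longrightarrow> finite (lexpow_verts V m)"
  unfolding lexpow_verts_def using finite_lists_length_eq[of V m] by (simp add: conj_commute)

lemma indep_poly_lexpow_0: "indep_poly (lexpow_verts V 0) (lexpow_edge E) z = 1 + z"
proof -
  have "lexpow_verts V 0 = {[]}"
    by (auto simp: lexpow_verts_def)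
  then have "independent_set (lexpow_verts V 0) (lexpow_edge E) S \<longleftrightarrow> S \<in> {{}, {[]}}" for S
    by (simp add: independent_set_def subset_singleton_iff) fastforce
  then have "{S. independent_set (lexpow_verts V 0) (lexpow_edge E) S} = {{}, {[]}}"
    by blast
  then show ?thesis
    by (simp add: indep_poly_def)
qed

text \<open>Words with different heads are adjacent exactly when the heads are; words with the same
  head, exactly when the tails are, as \<open>E\<close> is irreflexive. The empty word is excluded
  separately: no fibre contains it and \<open>hd []\<close> is unspecified.\<close>

lemma independent_set_lexpow_Suc_iff:
  assumes "\<And>x. \<not> E x x"
  shows "independent_set (lexpow_verts V (Suc m)) (lexpow_edge E) W \<longleftrightarrow>
    [] \<notin> W \<and> independent_set V E (hd ` W) \<and>
    (\<forall>x. independent_set (lexpow_verts V m) (lexpow_edge E) {w. x # w \<in> W})"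
    (is "?L \<longleftrightarrow> ?R")
proof
  assume L: ?L
  then have W: "\<exists>x w. v = x # w \<and> x \<in> V \<and> w \<in> lexpow_verts V m" if "v \<in> W" for v
  proof -
    have "v \<in> lexpow_verts V (Suc m)"
      using L that by (auto simp: independent_set_def)
    then show ?thesis
      by (cases v) (auto simp: lexpow_verts_def)
  qed
  have ind: "\<not> lexpow_edge E v v'" if "v \<in> W" "v' \<in> W" for v v'
    using L that by (auto simp: independent_set_def)
  have "[] \<notin> W"
    using W by fastforce
  moreover have "independent_set V E (hd ` W)"
    unfolding independent_set_def
  proof (intro conjI ballI subsetI)
    fix x y assume "x \<in> hd ` W" "y \<in> hd ` W"
    then obtain v w where "v \<in> W" "w \<in> W" "x = hd v" "y = hd w"
      by blast
    then show "\<not> E x y"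
      using W[of v] W[of w] ind[of v w] by auto
  next
    fix x assume "x \<in> hd ` W"
    then show "x \<in> V"
      using W by force
  qed
  moreover have "independent_set (lexpow_verts V m) (lexpow_edge E) {w. x # w \<in> W}" for x
    unfolding independent_set_def using W[of "x # _"] ind[of "x # _" "x # _"] by auto
  ultimately show ?R
    by blast
next
  assume R: ?R
  show ?L
    unfolding independent_set_def
  proof (intro conjI ballI subsetI)
    fix v assume v: "v \<in> W"
    then obtain x w where xw: "v = x # w"
      using R by (cases v) auto
    moreover have "x \<in> V"
      using R v xw unfolding independent_set_def by force
    moreover have "w \<in> lexpow_verts V m"
      using R v xw unfolding independent_set_def by blast
    ultimately show "v \<in> lexpow_verts V (Suc m)"
      by (simp add: lexpow_verts_def)
  next
    fix v v' assume v: "v \<in> W" "v' \<in> W"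
    then obtain x w x' w' where xw: "v = x # w" "v' = x' # w'"
      using R by (cases v; cases v') auto
    have "\<not> E x x'"
      using R v xw unfolding independent_set_def by (metis imageI list.sel(1))
    moreover have "\<not> lexpow_edge E w w'" if "x = x'"
      using R v xw that unfolding independent_set_def by blast
    ultimately show "\<not> lexpow_edge E v v'"
      by (simp add: xw)
  qed
qed

text \<open>An independent set of \<open>G[H]\<close> is an independent set of \<open>G\<close> together with a nonempty
  independent set of \<open>H\<close> in the fibre over each of its points.\<close>

lemma indep_poly_lexpow_Suc:
  assumes "simple_graph V E"
  shows "indep_poly (lexpow_verts V (Suc m)) (lexpow_edge E) z
    = indep_poly V E (indep_poly (lexpow_verts V m) (lexpow_edge E) z - 1)"
proof -
  have V: "finite V" and E: "\<And>x. \<not> E x x"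
    using assms by (auto simp: simple_graph_def)
  define I where "I = {S. independent_set V E S}"
  define H where "H = {T. independent_set (lexpow_verts V m) (lexpow_edge E) T}"
  define N where "N = H - {{}}"
  define W where "W = {U. independent_set (lexpow_verts V (Suc m)) (lexpow_edge E) U}"
  define glue where "glue = (\<lambda>(S, g). {x # w | x w. x \<in> S \<and> w \<in> (g x :: 'a list set)})"
  define cut where "cut = (\<lambda>U. (hd ` U, restrict (\<lambda>x. {w :: 'a list. x # w \<in> U}) (hd ` U)))"
  have finS: "finite S" if "S \<in> I" for S
    using that V finite_subset by (auto simp: I_def independent_set_def)
  have finI: "finite I"
    using V by (simp add: I_def finite_independent_sets)
  have "finite H"
    using V by (simp add: H_def finite_independent_sets finite_lexpow_verts)
  then have finN: "finite N"
    by (simp add: N_def)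
  have finT: "finite T" if "T \<in> N" for T
    using that V finite_subset[OF _ finite_lexpow_verts[OF V]]
    by (auto simp: N_def H_def independent_set_def)
  have "{} \<in> H"
    by (auto simp: H_def independent_set_def)
  then have "indep_poly (lexpow_verts V m) (lexpow_edge E) z - 1 = (\<Sum>T\<in>N. z ^ card T)"
    unfolding indep_poly_def N_def H_def[symmetric] using \<open>finite H\<close> by (simp add: sum_diff1)
  then have "indep_poly V E (indep_poly (lexpow_verts V m) (lexpow_edge E) z - 1)
      = (\<Sum>S\<in>I. \<Prod>x\<in>S. \<Sum>T\<in>N. z ^ card T)"
    by (simp add: indep_poly_def I_def)
  \<comment> \<open>Expanding the product turns it into a sum over all choices of one nonempty fibre
    per point of \<open>S\<close>.\<close>
  also have "\<dots> = (\<Sum>S\<in>I. \<Sum>g\<in>PiE S (\<lambda>_. N). \<Prod>x\<in>S. z ^ card (g x))"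
    using finS finN by (intro sum.cong prod_sum_PiE) auto
  also have "\<dots> = (\<Sum>(S, g)\<in>(SIGMA S:I. PiE S (\<lambda>_. N)). \<Prod>x\<in>S. z ^ card (g x))"
    using finI finS finN by (intro sum.Sigma) (auto intro!: finite_PiE)
  also have "\<dots> = (\<Sum>U\<in>W. z ^ card U)"
  proof (rule sum.reindex_bij_witness[of _ cut glue])
    fix U assume "U \<in> W"
    then have U: "[] \<notin> U" "hd ` U \<in> I" "\<And>x. {w. x # w \<in> U} \<in> H"
      unfolding W_def I_def H_def using independent_set_lexpow_Suc_iff[of E, OF E] by blast+
    show "glue (cut U) = U"
    proof (intro equalityI subsetI)
      fix v assume v: "v \<in> U"
      then have "v = hd v # tl v"
        using U(1) by (cases v) auto
      with v show "v \<in> glue (cut U)"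
        unfolding glue_def cut_def by (auto intro!: exI[of _ "hd v"] exI[of _ "tl v"])
    qed (auto simp: glue_def cut_def)
    have "{w. x # w \<in> U} \<noteq> {}" if "x \<in> hd ` U" for x
      using that U(1) by (metis (mono_tags, lifting) empty_Collect_eq imageE list.collapse)
    with U show "cut U \<in> (SIGMA S:I. PiE S (\<lambda>_. N))"
      by (auto simp: cut_def N_def)
  next
    fix p assume "p \<in> (SIGMA S:I. PiE S (\<lambda>_. N))"
    then obtain S g where p: "p = (S, g)" "S \<in> I" "g \<in> PiE S (\<lambda>_. N)"
      by blast
    then have g: "g x \<in> H" "g x \<noteq> {}" "finite (g x)" if "x \<in> S" for x
      using that PiE_mem[OF p(3) that] finT by (auto simp: N_def)
    have hd: "hd ` glue p = S"
      using g by (force simp: p glue_def image_iff)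
    have fib: "{w. x # w \<in> glue p} = (if x \<in> S then g x else {})" for x
      by (auto simp: p glue_def)
    have "{w. x # w \<in> glue p} \<in> H" for x
      using fib[of x] g \<open>{} \<in> H\<close> by auto
    moreover have "[] \<notin> glue p"
      by (auto simp: p glue_def)
    ultimately show "glue p \<in> W"
      unfolding W_def using independent_set_lexpow_Suc_iff[of E V m "glue p", OF E] hd p(2)
      by (auto simp: I_def H_def)
    have "restrict (\<lambda>x. {w. x # w \<in> glue p}) S = g"
      using p(3) by (auto simp: fib fun_eq_iff PiE_def extensional_def)
    then show "cut (glue p) = p"
      by (simp only: cut_def hd p(1)[symmetric])
    have "glue p = (\<lambda>(x, w). x # w) ` (SIGMA x:S. g x)"
      by (auto simp: p glue_def)
    then have "card (glue p) = card (SIGMA x:S. g x)"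
      by (simp add: card_image inj_on_def)
    also have "\<dots> = (\<Sum>x\<in>S. card (g x))"
      using p(2) finS g by (intro card_SigmaI) auto
    finally show "z ^ card (glue p) = (case p of (S, g) \<Rightarrow> \<Prod>x\<in>S. z ^ card (g x))"
      by (simp add: p power_sum)
  qed
  finally show ?thesis
    by (simp add: indep_poly_def W_def)
qed

subsection \<open>Goodman's inequality\<close>

text \<open>If \<open>e u v = 1\<close>, every \<open>w\<close> satisfies
  \<open>e u w + e v w - 1 \<le> e u w * e v w\<close>. Summing over all ordered triples bounds the
  triangle sum below by squared degrees, to which Cauchy-Schwarz applies.\<close>

lemma goodman_sum:
  fixes e :: "'a \<Rightarrow> 'a \<Rightarrow> real" and V :: "'a set" and M :: real
  assumes e: "\<And>u v. e u v \<in> {0, 1}" and sym: "\<And>u v. e u v = e v u"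
  defines "M \<equiv> \<Sum>u\<in>V. \<Sum>v\<in>V. e u v"
  shows "2 * M\<^sup>2 - (card V)\<^sup>2 * M \<le> card V * (\<Sum>u\<in>V. \<Sum>v\<in>V. \<Sum>w\<in>V. e u v * e u w * e v w)"
proof -
  define n where "n = real (card V)"
  define D where "D u = (\<Sum>v\<in>V. e u v)" for u
  define T where "T = (\<Sum>u\<in>V. \<Sum>v\<in>V. \<Sum>w\<in>V. e u v * e u w * e v w)"
  have M: "M = (\<Sum>u\<in>V. D u)"
    by (simp add: M_def D_def)
  have "e u v * (e u w + e v w - 1) \<le> e u v * e u w * e v w" for u v w
    using e[of u v] e[of u w] e[of v w] by auto
  then have "(\<Sum>u\<in>V. \<Sum>v\<in>V. \<Sum>w\<in>V. e u v * (e u w + e v w - 1)) \<le> T"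
    unfolding T_def by (intro sum_mono)
  also have "(\<Sum>u\<in>V. \<Sum>v\<in>V. \<Sum>w\<in>V. e u v * (e u w + e v w - 1))
      = (\<Sum>u\<in>V. \<Sum>v\<in>V. e u v * D u + e u v * D v - n * e u v)"
    unfolding D_def n_def
    by (simp add: algebra_simps sum.distrib sum_subtractf sum_distrib_left)
  also have "\<dots> = (\<Sum>u\<in>V. \<Sum>v\<in>V. e u v * D u) + (\<Sum>u\<in>V. \<Sum>v\<in>V. e u v * D v) - n * M"
    by (simp add: sum.distrib sum_subtractf sum_distrib_left M_def)
  also have "(\<Sum>u\<in>V. \<Sum>v\<in>V. e u v * D v) = (\<Sum>v\<in>V. \<Sum>u\<in>V. e u v * D v)"
    by (rule sum.swap)
  also have "\<dots> = (\<Sum>u\<in>V. \<Sum>v\<in>V. e u v * D u)"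
    by (intro sum.cong refl) (metis sym)
  also have "\<dots> = (\<Sum>u\<in>V. (D u)\<^sup>2)"
    by (simp add: D_def power2_eq_square flip: sum_distrib_right)
  finally have "2 * (\<Sum>u\<in>V. (D u)\<^sup>2) - n * M \<le> T"
    by simp
  then have "n * (2 * (\<Sum>u\<in>V. (D u)\<^sup>2) - n * M) \<le> n * T"
    by (intro mult_left_mono) (simp_all add: n_def)
  moreover have "M\<^sup>2 \<le> n * (\<Sum>u\<in>V. (D u)\<^sup>2)"
    unfolding M n_def by (metis sum_squared_le_sum_of_squares mult.commute)
  ultimately show ?thesis
    unfolding T_def[symmetric] by (simp add: algebra_simps power2_eq_square n_def)
qed

definition indep_count :: "'a set \<Rightarrow> ('a \<Rightarrow> 'a \<Rightarrow> bool) \<Rightarrow> nat \<Rightarrow> nat" where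
  "indep_count V E j = card {S. independent_set V E S \<and> card S = j}"

text \<open>Passes from sets to ordered tuples, over which the sums of \<open>goodman_sum\<close>
  run.\<close>

lemma card_distinct_independent_lists:
  assumes "finite V"
  shows "card {xs. distinct xs \<and> length xs = j \<and> independent_set V E (set xs)}
    = fact j * indep_count V E j"
proof -
  define A where "A = {S. independent_set V E S \<and> card S = j}"
  have fin: "finite A" "\<And>S. S \<in> A \<Longrightarrow> finite S"
    using assms finite_independent_sets[OF assms, of E]
    by (auto simp: A_def independent_set_def intro: finite_subset)
  have "{xs. distinct xs \<and> length xs = j \<and> independent_set V E (set xs)}
      = (\<Union>S\<in>A. permutations_of_set S)"
    by (auto simp: A_def permutations_of_set_def distinct_card)
  also have "card \<dots> = (\<Sum>S\<in>A. card (permutations_of_set S))"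
    using fin by (intro card_UN_disjoint) (auto dest: permutations_of_setD)
  also have "\<dots> = (\<Sum>S\<in>A. fact j)"
  proof (intro sum.cong refl)
    fix S assume "S \<in> A"
    then show "card (permutations_of_set S) = fact j"
      using fin(2)[of S] by (simp add: A_def)
  qed
  finally show ?thesis
    by (simp add: A_def indep_count_def)
qed

text \<open>This is \<open>goodman_sum\<close> for the complement graph, whose edges and triangles
  are the independent sets of sizes 2 and 3. They are counted there 2 and 6 times; a common factor 2
  is then cancelled.\<close>

lemma goodman_indep_count:
  fixes V :: "'a set" and E :: "'a \<Rightarrow> 'a \<Rightarrow> bool" and n m :: real
  assumes "simple_graph V E"
  defines "n \<equiv> real (card V)" and "m \<equiv> real (indep_count V E 2)"
  shows "4 * m\<^sup>2 - n\<^sup>2 * m \<le> 3 * n * indep_count V E 3"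
proof -
  have V: "finite V" and sym: "E x y = E y x" and irr: "\<not> E x x" for x y
    using assms by (auto simp: simple_graph_def)
  define e :: "'a \<Rightarrow> 'a \<Rightarrow> real" where "e u v = of_bool (u \<noteq> v \<and> \<not> E u v)" for u v
  have e01: "e u v \<in> {0, 1}" and esym: "e u v = e v u" for u v
    using sym[of u v] by (auto simp: e_def)
  define L where "L j = {xs. distinct xs \<and> length xs = j \<and> independent_set V E (set xs)}" for j
  have "(\<Sum>u\<in>V. \<Sum>v\<in>V. e u v) = (\<Sum>(u, v)\<in>V \<times> V. of_bool (u \<noteq> v \<and> \<not> E u v))"
    unfolding e_def by (rule sum.cartesian_product)
  also have "\<dots> = (\<Sum>p\<in>V \<times> V. of_bool ([fst p, snd p] \<in> L 2))"
    by (intro sum.cong) (auto simp: L_def independent_set_def irr sym)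
  also have "\<dots> = card ((V \<times> V) \<inter> {p. [fst p, snd p] \<in> L 2})"
    using V by simp
  also have "card ((V \<times> V) \<inter> {p. [fst p, snd p] \<in> L 2}) = card (L 2)"
    by (rule bij_betw_same_card[of "\<lambda>p. [fst p, snd p]"], rule bij_betwI[where g = "\<lambda>xs. (xs ! 0, xs ! 1)"])
      (auto simp: L_def independent_set_def length_Suc_conv numeral_2_eq_2)
  finally have M: "(\<Sum>u\<in>V. \<Sum>v\<in>V. e u v) = 2 * m"
    using card_distinct_independent_lists[OF V, of 2 E] by (simp add: L_def m_def fact_numeral)
  have "(\<Sum>u\<in>V. \<Sum>v\<in>V. \<Sum>w\<in>V. e u v * e u w * e v w)
      = (\<Sum>(u, v, w)\<in>V \<times> V \<times> V. e u v * e u w * e v w)"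
    by (simp add: sum.cartesian_product)
  also have "\<dots> = (\<Sum>p\<in>V \<times> V \<times> V. of_bool ([fst p, fst (snd p), snd (snd p)] \<in> L 3))"
    by (intro sum.cong) (auto simp: L_def independent_set_def irr sym e_def)
  also have "\<dots> = card ((V \<times> V \<times> V) \<inter> {p. [fst p, fst (snd p), snd (snd p)] \<in> L 3})"
    using V by simp
  also have "card ((V \<times> V \<times> V) \<inter> {p. [fst p, fst (snd p), snd (snd p)] \<in> L 3}) = card (L 3)"
    by (rule bij_betw_same_card[of "\<lambda>p. [fst p, fst (snd p), snd (snd p)]"],
        rule bij_betwI[where g = "\<lambda>xs. (xs ! 0, xs ! 1, xs ! 2)"])
      (auto simp: L_def independent_set_def length_Suc_conv numeral_3_eq_3)
  finally have T: "(\<Sum>u\<in>V. \<Sum>v\<in>V. \<Sum>w\<in>V. e u v * e u w * e v w) = 6 * indep_count V E 3"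
    using card_distinct_independent_lists[OF V, of 3 E] by (simp add: L_def fact_numeral)
  have "2 * (2 * m)\<^sup>2 - n\<^sup>2 * (2 * m) \<le> n * (6 * indep_count V E 3)"
    using goodman_sum[of e V, OF e01 esym] by (simp add: M T n_def)
  then show ?thesis
    by (simp add: power2_eq_square)
qed

subsection \<open>Roots of complex polynomials\<close>

text \<open>Both polynomials split over the complex numbers, so the hypothesis says that one
  multiset of roots contains the other.\<close>

lemma dvd_if_order_le:
  fixes p q :: "complex poly"
  assumes "p \<noteq> 0" "q \<noteq> 0" "\<And>x. order x p \<le> order x q"
  shows "p dvd q"
proof -
  define P where "P A = (\<Prod>x\<in>#A. [:-x, 1:])" for A :: "complex multiset"
  have dec: "r = smult (lead_coeff r) (P (proots r))" for r
    unfolding P_def by (rule complex_poly_decompose_multiset[symmetric])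
  have "proots p \<subseteq># proots q"
    using assms by (intro mset_subset_eqI) simp
  then have "P (proots q) = P (proots p) * P (proots q - proots p)"
    unfolding P_def by (metis image_mset_union prod_mset_Un subset_mset.add_diff_inverse)
  then have "P (proots p) dvd P (proots q)"
    by simp
  then have "smult (lead_coeff p) (P (proots p)) dvd smult (lead_coeff q) (P (proots q))"
    using assms by (simp add: smult_dvd_iff dvd_smult_iff)
  then show ?thesis
    using dec by metis
qed

lemma degree_diff_const: "degree p > 0 \<Longrightarrow> degree (p - [:c:]) = degree p"
  for p :: "'a::ab_group_add poly"
  using degree_add_eq_left[of "[:-c:]" p] by (simp add: diff_conv_add_uminus del: add_uminus_conv_diff)

lemma lead_coeff_diff_const:
  "degree p > 0 \<Longrightarrow> lead_coeff (p - [:c:]) = lead_coeff p"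
  for p :: "'a::ab_group_add poly"
  by (simp add: degree_diff_const coeff_pCons split: nat.split)

text \<open>The norm of \<open>poly p z\<close> is that of the leading coefficient times the
  distances from \<open>z\<close> to all roots, none of which is below the distance to the nearest
  root.\<close>

lemma nearby_root:
  fixes p :: "complex poly"
  assumes "degree p > 0"
  obtains r where "poly p r = 0" "norm (lead_coeff p) * dist z r ^ degree p \<le> norm (poly p z)"
proof -
  obtain root where root: "smult (lead_coeff p) (\<Prod>i<degree p. [:- root i, 1:]) = p"
    by (rule complex_poly_decompose')
  define D where "D = (\<lambda>i. dist z (root i)) ` {..<degree p}"
  have D: "finite D" "D \<noteq> {}"
    using assms by (auto simp: D_def)
  then have "Min D \<in> D"
    by (rule Min_in)
  then obtain i where i: "i < degree p" "Min D = dist z (root i)"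
    by (subst (asm) (2) D_def) blast
  have eval: "poly p x = lead_coeff p * (\<Prod>i<degree p. x - root i)" for x
  proof -
    have "poly p x = poly (smult (lead_coeff p) (\<Prod>i<degree p. [:- root i, 1:])) x"
      by (simp only: root)
    then show ?thesis
      by (simp add: poly_prod)
  qed
  show ?thesis
  proof
    show "poly p (root i) = 0"
      using i(1) by (subst eval) (auto intro!: bexI[of _ i])
    have "dist z (root i) \<le> dist z (root j)" if "j < degree p" for j
      using Min_le[OF D(1), of "dist z (root j)"] that unfolding i(2) by (simp add: D_def)
    then have "(\<Prod>j<degree p. dist z (root i)) \<le> (\<Prod>j<degree p. dist z (root j))"
      by (intro prod_mono) auto
    then have "dist z (root i) ^ degree p \<le> (\<Prod>j<degree p. norm (z - root j))"
      by (simp add: dist_norm)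
    then show "norm (lead_coeff p) * dist z (root i) ^ degree p \<le> norm (poly p z)"
      by (simp add: eval[of z] norm_mult prod_norm mult_left_mono)
  qed
qed

subsection \<open>Hausdorff limits of iterated preimages\<close>

text \<open>Compactness bounds the set of distances, so that its real supremum is an upper
  bound.\<close>

lemma infdist_le_hausdorff_dist:
  assumes "compact S" "x \<in> S"
  shows "infdist x T \<le> hausdorff_dist S T"
    and "infdist x T \<le> hausdorff_dist T S"
proof -
  have "compact ((\<lambda>x. infdist x T) ` S)"
    using assms by (intro compact_continuous_image continuous_intros)
  then have "bdd_above ((\<lambda>x. infdist x T) ` S)"
    by (intro bounded_imp_bdd_above compact_imp_bounded)
  then have "infdist x T \<le> (SUP x\<in>S. infdist x T)"
    using assms(2) by (rule cSUP_upper2) simp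
  then show "infdist x T \<le> hausdorff_dist S T" "infdist x T \<le> hausdorff_dist T S"
    by (auto simp: hausdorff_dist_def)
qed

text \<open>Take for \<open>w m\<close> a point of \<open>R m\<close> nearest to \<open>z\<close>;
  it is arbitrary for the finitely many \<open>m\<close> where \<open>R m\<close> may be
  empty.\<close>

lemma hausdorff_limit_approx:
  fixes R :: "nat \<Rightarrow> 'a::{heine_borel} set"
  assumes "\<And>m. finite (R m)" "\<forall>\<^sub>F m in sequentially. R m \<noteq> {}" "compact J"
    and "(\<lambda>m. hausdorff_dist (R m) J) \<longlonglongrightarrow> 0" and "z \<in> J"
  obtains w where "\<forall>\<^sub>F m in sequentially. w m \<in> R m" "w \<longlonglongrightarrow> z"
proof -
  define w where "w m = (SOME v. v \<in> R m \<and> dist z v = infdist z (R m))" for m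
  have w: "w m \<in> R m \<and> dist z (w m) = infdist z (R m)" if ne: "R m \<noteq> {}" for m
  proof -
    obtain v where "v \<in> R m" "infdist z (R m) = dist z v"
      by (rule infdist_attains_inf[of "R m" z, OF finite_imp_closed[OF assms(1)] ne])
    then have "\<exists>v. v \<in> R m \<and> dist z v = infdist z (R m)"
      by auto
    from someI_ex[OF this] show ?thesis
      by (simp only: w_def)
  qed
  have "\<forall>\<^sub>F m in sequentially. dist (w m) z \<le> hausdorff_dist (R m) J"
    using assms(2)
  proof eventually_elim
    case (elim m)
    then show ?case
      using w[of m] infdist_le_hausdorff_dist(2)[OF assms(3,5), of "R m"]
      by (simp add: dist_commute)
  qed
  then have "(\<lambda>m. dist (w m) z) \<longlonglongrightarrow> 0"
    using assms(4) by (intro tendsto_sandwich[OF _ _ tendsto_const assms(4)]) auto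
  then have "w \<longlonglongrightarrow> z"
    by (rule iffD2[OF tendsto_dist_iff])
  moreover have "\<forall>\<^sub>F m in sequentially. w m \<in> R m"
    using assms(2) by eventually_elim (use w in blast)
  ultimately show ?thesis
    using that by blast
qed

lemma hausdorff_limit_member:
  fixes R :: "nat \<Rightarrow> 'a::{heine_borel} set"
  assumes "\<And>m. finite (R m)" "compact J" "J \<noteq> {}"
    and "(\<lambda>m. hausdorff_dist (R m) J) \<longlonglongrightarrow> 0"
    and "\<forall>\<^sub>F m in sequentially. w m \<in> R m" "w \<longlonglongrightarrow> z"
  shows "z \<in> J"
proof -
  have "\<forall>\<^sub>F m in sequentially. infdist (w m) J \<le> hausdorff_dist (R m) J"
    using assms(5) by eventually_elim (use infdist_le_hausdorff_dist(1) assms(1) finite_imp_compact in blast)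
  then have "(\<lambda>m. infdist (w m) J) \<longlonglongrightarrow> 0"
    by (intro tendsto_sandwich[OF _ _ tendsto_const assms(4)]) (auto simp: infdist_nonneg)
  moreover have "(\<lambda>m. infdist (w m) J) \<longlonglongrightarrow> infdist z J"
    using assms(6) by (rule tendsto_infdist)
  ultimately have "infdist z J = 0"
    by (rule LIMSEQ_unique[rotated])
  then show ?thesis
    using assms(2,3) by (simp add: in_closed_iff_infdist_zero compact_imp_closed)
qed

text \<open>Approximations of \<open>z\<close> are pushed forward by continuity of \<open>p\<close>;
  approximations of \<open>poly p z\<close> are pulled back to preimages close to \<open>z\<close>,
  supplied by \<open>nearby_root\<close>.\<close>

lemma hausdorff_limit_invariant:
  fixes R :: "nat \<Rightarrow> complex set" and p :: "complex poly"
  assumes R: "\<And>m. finite (R m)" "\<forall>\<^sub>F m in sequentially. R m \<noteq> {}"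
    and J: "compact J" "J \<noteq> {}" "(\<lambda>m. hausdorff_dist (R m) J) \<longlonglongrightarrow> 0"
    and Suc: "\<And>m. R (Suc m) = {z. poly p z \<in> R m}" and deg: "degree p > 0"
  shows "poly p z \<in> J \<longleftrightarrow> z \<in> J"
proof
  assume "z \<in> J"
  then obtain w where w: "\<forall>\<^sub>F m in sequentially. w m \<in> R m" "w \<longlonglongrightarrow> z"
    using hausdorff_limit_approx[OF R J(1,3)] by metis
  have "\<forall>\<^sub>F m in sequentially. w (Suc m) \<in> R (Suc m)"
    using w(1) by (subst eventually_sequentially_Suc)
  then have "\<forall>\<^sub>F m in sequentially. poly p (w (Suc m)) \<in> R m"
    by eventually_elim (simp add: Suc)
  moreover have "(\<lambda>m. poly p (w (Suc m))) \<longlonglongrightarrow> poly p z"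
    by (intro tendsto_intros LIMSEQ_Suc w(2))
  ultimately show "poly p z \<in> J"
    by (rule hausdorff_limit_member[OF R(1) J])
next
  assume "poly p z \<in> J"
  then obtain y where y: "\<forall>\<^sub>F m in sequentially. y m \<in> R m" "y \<longlonglongrightarrow> poly p z"
    using hausdorff_limit_approx[OF R J(1,3)] by metis
  define l d where "l = norm (lead_coeff p)" and "d = degree p"
  have l: "l > 0"
    using deg by (auto simp: l_def)
  \<comment> \<open>The degree and leading coefficient of \<open>p - [:y m:]\<close> do not depend
    on \<open>m\<close>, so the estimate is uniform.\<close>
  have "\<exists>r. poly p r = y m \<and> l * dist z r ^ d \<le> dist (y m) (poly p z)" for m
  proof -
    have "degree (p - [:y m:]) = degree p" "lead_coeff (p - [:y m:]) = lead_coeff p"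
      using degree_diff_const[OF deg] lead_coeff_diff_const[OF deg] by blast+
    then show ?thesis
      using nearby_root[of "p - [:y m:]" z] deg
      by (metis (no_types, lifting) d_def l_def dist_commute dist_norm poly_const_conv
          poly_diff right_minus_eq)
  qed
  then obtain r where r: "\<And>m. poly p (r m) = y m" "\<And>m. l * dist z (r m) ^ d \<le> dist (y m) (poly p z)"
    by metis
  have "(\<lambda>m. dist (y m) (poly p z)) \<longlonglongrightarrow> 0"
    using y(2) by (rule iffD1[OF tendsto_dist_iff])
  then have "(\<lambda>m. l * dist z (r m) ^ d) \<longlonglongrightarrow> 0"
    by (rule tendsto_sandwich[OF _ _ tendsto_const, rotated 2]) (use r(2) l in simp_all)
  then have "(\<lambda>m. inverse l * (l * dist z (r m) ^ d)) \<longlonglongrightarrow> inverse l * 0"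
    by (intro tendsto_intros)
  then have "(\<lambda>m. root d (dist z (r m) ^ d)) \<longlonglongrightarrow> root d 0"
    using l by (intro tendsto_intros) (simp add: mult.assoc[symmetric])
  then have "(\<lambda>m. dist (r m) z) \<longlonglongrightarrow> 0"
    using deg by (simp add: d_def real_root_power_cancel dist_commute)
  then have "r \<longlonglongrightarrow> z"
    by (rule iffD2[OF tendsto_dist_iff])
  \<comment> \<open>Since \<open>r m\<close> lies in \<open>R (Suc m)\<close>, the index has to be
    shifted by one.\<close>
  then have "(\<lambda>m. r (m - 1)) \<longlonglongrightarrow> z"
    by (subst filterlim_sequentially_Suc[symmetric]) simp
  moreover have "\<forall>\<^sub>F m in sequentially. r (m - 1) \<in> R m"
  proof -
    have "\<forall>\<^sub>F m in sequentially. r m \<in> R (Suc m)"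
      using y(1) by eventually_elim (simp add: Suc r(1))
    then show ?thesis
      by (subst eventually_sequentially_Suc[symmetric]) simp
  qed
  ultimately show "z \<in> J"
    using hausdorff_limit_member[OF R(1) J, of "\<lambda>m. r (m - 1)"] by simp
qed

subsection \<open>The Chebyshev equation\<close>

text \<open>In an affine coordinate on the segment, \<open>F\<close> maps the unit interval to
  itself. At an interior point sent to an endpoint the real part is extremal, and the imaginary part
  is constant nearby, so both derivatives vanish.\<close>

lemma segment_invariant_critical:
  fixes F :: "complex poly"
  assumes ab: "a \<noteq> b"
    and inv: "\<And>z. z \<in> closed_segment a b \<Longrightarrow> poly F z \<in> closed_segment a b"
    and z: "z \<in> closed_segment a b" "z \<noteq> a" "z \<noteq> b" and Fz: "poly F z = a \<or> poly F z = b"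
  shows "poly (pderiv F) z = 0"
proof -
  obtain t0 :: real where t0: "0 \<le> t0" "t0 \<le> 1" "z = a + t0 * (b - a)"
    using z(1) by (auto simp: closed_segment_image_interval algebra_simps scaleR_conv_of_real)
  with z have t01: "0 < t0" "t0 < 1"
    by (auto simp: less_le)
  \<comment> \<open>The chain-rule factor \<open>b - a\<close> cancels the denominator, so the
    derivative of \<open>h\<close> at \<open>t0\<close> is exactly that of \<open>F\<close> at
    \<open>z\<close>.\<close>
  define h where "h t = (poly F (a + of_real t * (b - a)) - a) / (b - a)" for t :: real
  have h01: "Im (h t) = 0 \<and> 0 \<le> Re (h t) \<and> Re (h t) \<le> 1" if "0 < t" "t < 1" for t
  proof -
    have "a + of_real t * (b - a) \<in> closed_segment a b"
      using that by (auto simp: closed_segment_image_interval algebra_simps scaleR_conv_of_real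
          intro!: image_eqI[of _ _ t])
    from inv[OF this] obtain s :: real where "0 \<le> s" "s \<le> 1"
      "poly F (a + of_real t * (b - a)) = a + of_real s * (b - a)"
      by (auto simp: closed_segment_image_interval algebra_simps scaleR_conv_of_real)
    then show ?thesis
      using ab by (simp add: h_def)
  qed
  have "(h has_vector_derivative poly (pderiv F) z) (at t0)"
  proof -
    define g where "g u = (poly F (a + u * (b - a)) - a) / (b - a)" for u :: complex
    have "(g has_field_derivative poly (pderiv F) z) (at (of_real t0))"
      unfolding g_def t0(3) using ab by (auto intro!: derivative_eq_intros)
    then have "((\<lambda>t. g (of_real t)) has_vector_derivative poly (pderiv F) z) (at t0)"
      by (rule has_vector_derivative_real_field)
    then show ?thesis
      by (simp add: g_def h_def[abs_def])
  qed
  then have Re: "DERIV (\<lambda>t. Re (h t)) t0 :> Re (poly (pderiv F) z)"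
    and Im: "DERIV (\<lambda>t. Im (h t)) t0 :> Im (poly (pderiv F) z)"
    by (auto simp: has_real_derivative_iff_has_vector_derivative
        intro: bounded_linear.has_vector_derivative[OF bounded_linear_Re]
          bounded_linear.has_vector_derivative[OF bounded_linear_Im])
  define \<delta> where "\<delta> = min t0 (1 - t0)"
  have \<delta>: "0 < \<delta>" "\<And>t. \<bar>t0 - t\<bar> < \<delta> \<Longrightarrow> 0 < t \<and> t < 1"
    using t01 by (auto simp: \<delta>_def)
  have "Im (poly (pderiv F) z) = 0"
    using DERIV_local_const[OF Im \<delta>(1)] \<delta>(2) h01 t01 by simp
  moreover have "Re (h t0) = 0 \<or> Re (h t0) = 1"
    using Fz ab by (auto simp: h_def t0(3))
  then have "Re (poly (pderiv F) z) = 0"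
  proof
    assume "Re (h t0) = 0"
    then show ?thesis
      using DERIV_local_min[OF Re \<delta>(1)] \<delta>(2) h01 by simp
  next
    assume "Re (h t0) = 1"
    then show ?thesis
      using DERIV_local_max[OF Re \<delta>(1)] \<delta>(2) h01 by simp
  qed
  ultimately show ?thesis
    by (simp add: complex_eq_iff)
qed

text \<open>The points of the segment mapped to its endpoints are critical, except for the endpoints
  themselves. Hence every root of the left-hand side is a root of the right-hand side of at least
  the same order, and the degrees agree.\<close>

lemma segment_invariant_ode:
  fixes F :: "complex poly"
  assumes ab: "a \<noteq> b" and deg: "degree F > 0"
    and inv: "\<And>z. poly F z \<in> closed_segment a b \<longleftrightarrow> z \<in> closed_segment a b"
  shows "smult (of_nat (degree F) ^ 2) ((F - [:a:]) * (F - [:b:]))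
    = [:-a, 1:] * [:-b, 1:] * (pderiv F)\<^sup>2" (is "smult _ ?P = ?Q")
proof -
  have F': "pderiv F \<noteq> 0" and Fa: "F - [:a:] \<noteq> 0" and Fb: "F - [:b:] \<noteq> 0"
    using deg by (auto simp: pderiv_eq_0_iff)
  then have P: "?P \<noteq> 0" and Q: "?Q \<noteq> 0"
    by (simp_all del: mult_pCons_left mult_pCons_right)
  have pd: "pderiv (F - [:c:]) = pderiv F" for c
    by (simp add: pderiv_diff pderiv_pCons)
  have ordQ: "order z ?Q = order z [:-a, 1:] + order z [:-b, 1:] + 2 * order z (pderiv F)" for z
    using Q F' by (simp add: order_mult power2_eq_square del: mult_pCons_left mult_pCons_right)
  \<comment> \<open>With \<open>o\<close> the order of \<open>pderiv F\<close> at \<open>z\<close>,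
    an endpoint \<open>z\<close> contributes a linear factor and
    \<open>1 + 2 * o \<ge> o + 1\<close>; elsewhere \<open>z\<close> is critical, so
    \<open>o \<ge> 1\<close> and \<open>2 * o \<ge> o + 1\<close>.\<close>
  have le: "Suc (order z (pderiv F)) \<le> order z ?Q" if "poly F z = a \<or> poly F z = b" for z
  proof -
    have z: "z \<in> closed_segment a b"
      using inv[of z] that by auto
    consider "z = a" | "z = b" | "z \<noteq> a" "z \<noteq> b"
      by blast
    then show ?thesis
    proof cases
      case 3
      then have "poly (pderiv F) z = 0"
        using segment_invariant_critical[OF ab _ z] inv that by blast
      then show ?thesis
        using F' by (simp add: ordQ order_root Suc_le_eq del: mult_pCons_left mult_pCons_right)
    next
      case 1
      have "order a [:-a, 1:] \<noteq> 0"
        by (simp add: order_eq_0_iff)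
      then show ?thesis
        unfolding ordQ 1 by linarith
    next
      case 2
      have "order b [:-b, 1:] \<noteq> 0"
        by (simp add: order_eq_0_iff)
      then show ?thesis
        unfolding ordQ 2 by linarith
    qed
  qed
  have "order z ?P \<le> order z ?Q" for z
  proof -
    consider "poly F z = a" | "poly F z = b" | "poly F z \<noteq> a" "poly F z \<noteq> b"
      by blast
    then show ?thesis
    proof cases
      case 1
      then have "order z (F - [:a:]) = Suc (order z (pderiv F))" "order z (F - [:b:]) = 0"
        using order_pderiv[of "F - [:a:]" z] Fa Fb ab by (auto simp: pd order_0I)
      then show ?thesis
        using le[of z] 1 P by (simp add: order_mult)
    next
      case 2
      then have "order z (F - [:b:]) = Suc (order z (pderiv F))" "order z (F - [:a:]) = 0"
        using order_pderiv[of "F - [:b:]" z] Fa Fb ab by (auto simp: pd order_0I)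
      then show ?thesis
        using le[of z] 2 P by (simp add: order_mult)
    next
      case 3
      then have "order z ?P = 0"
        by (intro order_0I) simp
      then show ?thesis
        by simp
    qed
  qed
  then have "?P dvd ?Q"
    using P Q by (intro dvd_if_order_le) auto
  then obtain K where K: "?Q = ?P * K"
    by blast
  have "K \<noteq> 0"
    using K Q by auto
  have "degree ?P = 2 * degree F"
    using Fa Fb deg by (simp add: degree_mult_eq degree_diff_const)
  moreover have "degree ?Q = 2 * degree F"
    using F' deg by (simp add: degree_mult_eq power2_eq_square degree_pderiv
        del: mult_pCons_left mult_pCons_right)
  ultimately have "degree K = 0"
    using degree_mult_eq[OF P \<open>K \<noteq> 0\<close>] unfolding K[symmetric] by linarith
  then obtain k where k: "K = [:k:]"
    using degree_eq_zeroE by blast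
  \<comment> \<open>The constant quotient \<open>k\<close> is read off from the leading
    coefficients.\<close>
  have "lead_coeff (pderiv F) = of_nat (degree F) * lead_coeff F"
    using deg by (simp add: degree_pderiv coeff_pderiv)
  then have "lead_coeff ?Q = (of_nat (degree F) * lead_coeff F)\<^sup>2"
    by (simp add: lead_coeff_mult lead_coeff_power del: mult_pCons_left mult_pCons_right)
  moreover have "lead_coeff ?Q = k * (lead_coeff F)\<^sup>2"
    unfolding K k using deg
    by (simp only: lead_coeff_mult lead_coeff_diff_const) (simp add: power2_eq_square)
  ultimately have "k = of_nat (degree F) ^ 2"
    using deg by (auto simp: power_mult_distrib)
  then show ?thesis
    using K by (simp add: k)
qed

text \<open>Differentiating the quadratic equation produces a common factor \<open>pderiv F\<close>;
  cancelling it leaves an equation linear in \<open>F\<close>.\<close>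

lemma chebyshev_ode_linear:
  fixes F :: "complex poly" and d :: complex
  assumes ode: "smult (d\<^sup>2) ((F - [:a:]) * F) = [:-a, 1:] * [:0, 1:] * (pderiv F)\<^sup>2"
    and F': "pderiv F \<noteq> 0"
  shows "smult (2 * d\<^sup>2) F - [:a * d\<^sup>2:]
    = [:-a, 2:] * pderiv F + smult 2 ([:0, -a, 1:] * pderiv (pderiv F))"
proof -
  define X :: "complex poly" where "X = [:0, -a, 1:]"
  have X: "[:-a, 1:] * [:0, 1:] = X" "pderiv X = [:-a, 2:]"
    by (simp_all add: X_def pderiv_pCons)
  have "pderiv (smult (d\<^sup>2) ((F - [:a:]) * F)) = pderiv (X * (pderiv F)\<^sup>2)"
    unfolding ode X ..
  then have "pderiv F * smult (d\<^sup>2) (2 * F - [:a:])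
      = pderiv F * ([:-a, 2:] * pderiv F + 2 * X * pderiv (pderiv F))"
    unfolding pderiv_smult pderiv_mult pderiv_diff pderiv_power X(2) power2_eq_square
    by (simp add: algebra_simps pderiv_pCons flip: smult_add_right)
  then have "smult (d\<^sup>2) (2 * F - [:a:]) = [:-a, 2:] * pderiv F + 2 * X * pderiv (pderiv F)"
    using F' unfolding mult_cancel_left by blast
  moreover have "2 * Y = smult 2 Y" for Y :: "complex poly"
    by (simp add: numeral_poly)
  ultimately show ?thesis
    unfolding X_def[symmetric] by (simp add: algebra_simps smult_diff_right)
qed

text \<open>Comparison of coefficients. The constant on the left-hand side enters only at index 0,
  which gives the starting value; all other indices give a two-term recurrence.\<close>

lemma chebyshev_ode_coeffs:
  fixes F :: "complex poly" and d :: complex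
  assumes ode: "smult (2 * d\<^sup>2) F - [:a * d\<^sup>2:]
      = [:-a, 2:] * pderiv F + smult 2 ([:0, -a, 1:] * pderiv (pderiv F))"
    and a: "a \<noteq> 0" and F0: "coeff F 0 = 0"
  shows "coeff F 1 = d\<^sup>2"
    and "j \<ge> 1 \<Longrightarrow> 2 * (d\<^sup>2 - of_nat j ^ 2) * coeff F j
      = - a * of_nat (j + 1) * of_nat (2 * j + 1) * coeff F (Suc j)"
proof -
  have "coeff (smult (2 * d\<^sup>2) F - [:a * d\<^sup>2:]) 0
      = coeff ([:-a, 2:] * pderiv F + smult 2 ([:0, -a, 1:] * pderiv (pderiv F))) 0"
    unfolding ode ..
  then have "a * d\<^sup>2 = a * coeff F 1"
    by (simp add: F0 coeff_pderiv)
  then show "coeff F 1 = d\<^sup>2"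
    using a by simp
next
  assume "j \<ge> 1"
  then obtain i where j: "j = Suc i"
    by (cases j) auto
  have "coeff (smult (2 * d\<^sup>2) F - [:a * d\<^sup>2:]) j
      = coeff ([:-a, 2:] * pderiv F + smult 2 ([:0, -a, 1:] * pderiv (pderiv F))) j"
    unfolding ode ..
  then have "2 * d\<^sup>2 * coeff F (Suc i) = - a * (of_nat (Suc (Suc i)) * coeff F (Suc (Suc i)))
      + 2 * (of_nat (Suc i) * coeff F (Suc i))
      + 2 * (- a * (of_nat (Suc i) * (of_nat (Suc (Suc i)) * coeff F (Suc (Suc i))))
        + of_nat i * of_nat (Suc i) * coeff F (Suc i))"
    by (cases i) (simp_all add: j coeff_pderiv coeff_pCons algebra_simps)
  then show "2 * (d\<^sup>2 - of_nat j ^ 2) * coeff F j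
      = - a * of_nat (j + 1) * of_nat (2 * j + 1) * coeff F (Suc j)"
    by (simp add: j power2_eq_square algebra_simps)
qed

text \<open>The factors \<open>d + j\<close> and \<open>d - j\<close> of the difference of squares
  each come from an absorption identity, with \<open>B\<close> as the intermediate binomial.\<close>

lemma choose_add_two:
  assumes "1 \<le> j" "j \<le> d"
  shows "of_nat (2 * j) * of_nat (2 * j + 1) * of_nat ((d + j) choose (2 * j + 1))
    = (of_nat d ^ 2 - of_nat j ^ 2) * (of_nat ((d + j - 1) choose (2 * j - 1)) :: 'a::field_char_0)"
proof -
  obtain i where j: "j = Suc i"
    using assms by (cases j) auto
  obtain e where d: "d = j + e"
    using assms le_Suc_ex by blast
  define A B C where "A = ((d + j) choose (2 * j + 1))" and "B = ((d + j - 1) choose (2 * j))"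
    and "C = ((d + j - 1) choose (2 * j - 1))"
  have "(2 * j + 1) * A = (d + j) * B"
    using Suc_times_binomial_eq[of "d + j - 1" "2 * j"] by (simp add: A_def B_def j mult.commute)
  moreover have "2 * j * B = e * C"
    using binomial_absorb_comp[of "d + j - 1" "2 * j - 1"]
      binomial_absorption[of "2 * j - 1" "d + j - 1"]
    by (simp add: B_def C_def j d) 
  ultimately have "2 * j * (2 * j + 1) * A = (d + j) * e * C"
    by (metis mult.assoc mult.left_commute)
  then have "of_nat (2 * j * (2 * j + 1) * A) = (of_nat ((d + j) * e * C) :: 'a)"
    by simp
  also have "\<dots> = of_nat ((d + j) * e) * of_nat C"
    by simp
  also have "of_nat ((d + j) * e) = (of_nat d ^ 2 - of_nat j ^ 2 :: 'a)"
    by (simp add: d power2_eq_square algebra_simps)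
  finally show ?thesis
    by (simp add: A_def C_def algebra_simps)
qed

text \<open>Up to normalisation, these are the coefficients of the Chebyshev polynomial of degree
  \<open>d\<close> shifted to the segment between \<open>- 4 / k\<close> and \<open>0\<close>.\<close>

lemma chebyshev_recurrence:
  fixes c :: "nat \<Rightarrow> 'a::field_char_0"
  assumes c1: "c 1 = of_nat d ^ 2"
    and rec: "\<And>j. j \<ge> 1 \<Longrightarrow> k * (of_nat d ^ 2 - of_nat j ^ 2) * c j
      = 2 * of_nat (j + 1) * of_nat (2 * j + 1) * c (Suc j)"
    and "1 \<le> j" "j \<le> d"
  shows "of_nat j * c j = k ^ (j - 1) * of_nat d * of_nat ((d + j - 1) choose (2 * j - 1))"
  using assms(3,4)
proof (induction j rule: dec_induct)
  case base
  then show ?case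
    by (simp add: c1[simplified] power2_eq_square)
next
  case (step i)
  define C C' where "C = (of_nat ((d + i - 1) choose (2 * i - 1)) :: 'a)"
    and "C' = (of_nat ((d + i) choose (2 * i + 1)) :: 'a)"
  define D where "D = of_nat d ^ 2 - (of_nat i ^ 2 :: 'a)"
  define x y where "x = (of_nat (i + 1) :: 'a)" and "y = (of_nat (2 * i + 1) :: 'a)"
  have CC: "of_nat (2 * i) * y * C' = D * C"
    unfolding C_def C'_def D_def y_def using step by (intro choose_add_two) simp_all
  have IH: "of_nat i * c i = k ^ (i - 1) * of_nat d * C"
    using step by (simp add: C_def)
  have j: "of_nat (2 * i) = 2 * (of_nat i :: 'a)" "(of_nat i :: 'a) \<noteq> 0" "k ^ i = k * k ^ (i - 1)"
    using step by (simp_all flip: power_Suc)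
  have y: "y \<noteq> 0"
    unfolding y_def by (simp only: of_nat_eq_0_iff)
  \<comment> \<open>Multiplying by \<open>2 * of_nat i * y\<close> brings in both the recurrence and
    \<open>CC\<close>; the factor is nonzero and cancels at the end.\<close>
  have "2 * of_nat i * y * (x * c (Suc i)) = of_nat i * (2 * x * y * c (Suc i))"
    by (simp add: algebra_simps)
  also have "\<dots> = of_nat i * (k * D * c i)"
    using rec[of i] step by (simp only: D_def x_def y_def)
  also have "\<dots> = k * k ^ (i - 1) * of_nat d * (D * C)"
    using IH by (simp add: algebra_simps)
  also have "\<dots> = 2 * of_nat i * y * (k ^ i * of_nat d * C')"
    unfolding CC[symmetric] j by (simp add: algebra_simps)
  finally have "x * c (Suc i) = k ^ i * of_nat d * C'"
    using y j(2) by simp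
  then show ?case
    by (simp add: x_def C'_def)
qed

subsection \<open>The reduced independence polynomial\<close>

text \<open>The polynomial \<open>f\<close> of the overview: dropping the empty set subtracts 1,
  which turns passing to lexicographic powers into iteration.\<close>

definition reduced_indep_poly :: "'a set \<Rightarrow> ('a \<Rightarrow> 'a \<Rightarrow> bool) \<Rightarrow> complex poly" where
  "reduced_indep_poly V E = (\<Sum>S\<in>{S. independent_set V E S} - {{}}. monom 1 (card S))"

lemma poly_reduced_indep_poly:
  assumes "finite V"
  shows "poly (reduced_indep_poly V E) z = indep_poly V E z - 1"
proof -
  have "{} \<in> {S. independent_set V E S}"
    by (simp add: independent_set_def)
  then show ?thesis
    unfolding reduced_indep_poly_def indep_poly_def
    using finite_independent_sets[OF assms, of E] by (simp add: poly_sum poly_monom sum_diff1)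
qed

lemma coeff_reduced_indep_poly:
  assumes "finite V"
  shows "coeff (reduced_indep_poly V E) j = (if j = 0 then 0 else of_nat (indep_count V E j))"
proof -
  define I where "I = {S. independent_set V E S} - {{}}"
  have I: "finite I"
    using finite_independent_sets[OF assms, of E] by (simp add: I_def)
  have nonzero: "card S \<noteq> 0" if "S \<in> I" for S
  proof -
    have "finite S"
      using that assms finite_subset by (auto simp: I_def independent_set_def)
    then show ?thesis
      using that by (simp add: I_def)
  qed
  have "coeff (reduced_indep_poly V E) j = (\<Sum>S\<in>I. of_bool (card S = j))"
    by (simp add: reduced_indep_poly_def I_def coeff_sum of_bool_def)
  also have "\<dots> = of_nat (card (I \<inter> {S. card S = j}))"
    using I by simp
  also have "I \<inter> {S. card S = j} = (if j = 0 then {} else {S. independent_set V E S \<and> card S = j})"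
  proof (cases "j = 0")
    case True
    have "I \<inter> {S. card S = 0} = {}"
      using nonzero by blast
    with True show ?thesis
      by simp
  next
    case False
    then show ?thesis
      by (auto simp: I_def)
  qed
  finally show ?thesis
    by (simp add: indep_count_def)
qed

lemma indep_poly_lexpow:
  assumes "simple_graph V E"
  shows "indep_poly (lexpow_verts V m) (lexpow_edge E) z
    = 1 + (poly (reduced_indep_poly V E) ^^ m) z"
proof (induction m)
  case 0
  show ?case
    by (simp add: indep_poly_lexpow_0)
next
  case (Suc m)
  have "finite V"
    using assms by (simp add: simple_graph_def)
  then show ?case
    by (simp add: indep_poly_lexpow_Suc[OF assms] Suc poly_reduced_indep_poly)
qed

lemma lexpow_roots_eq:
  assumes "simple_graph V E"
  shows "lexpow_roots V E m = {z. (poly (reduced_indep_poly V E) ^^ m) z = -1}"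
  by (auto simp: lexpow_roots_def indep_poly_lexpow[OF assms] add_eq_0_iff)

lemma lexpow_roots_0: "simple_graph V E \<Longrightarrow> lexpow_roots V E 0 = {-1}"
  by (simp add: lexpow_roots_eq)

lemma lexpow_roots_Suc:
  assumes "simple_graph V E"
  shows "lexpow_roots V E (Suc m) = {z. poly (reduced_indep_poly V E) z \<in> lexpow_roots V E m}"
  by (simp add: lexpow_roots_eq[OF assms] funpow_Suc_right del: funpow.simps)

lemma finite_lexpow_roots:
  assumes "simple_graph V E" and deg: "degree (reduced_indep_poly V E) > 0"
  shows "finite (lexpow_roots V E m)"
proof (induction m)
  case 0
  show ?case
    by (simp add: lexpow_roots_0 assms)
next
  case (Suc m)
  define F where "F = reduced_indep_poly V E"
  have "finite {z. poly F z = y}" for y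
  proof -
    have "F - [:y:] \<noteq> 0"
      using deg by (auto simp: F_def)
    then show ?thesis
      using poly_roots_finite[of "F - [:y:]"] by simp
  qed
  moreover have "lexpow_roots V E (Suc m) = (\<Union>y\<in>lexpow_roots V E m. {z. poly F z = y})"
    unfolding lexpow_roots_Suc[OF assms(1)] F_def by blast
  ultimately show ?case
    using Suc by simp
qed

text \<open>A constant \<open>F\<close> is zero because \<open>coeff F 0 = 0\<close>; its iterates
  from the first on then never take the value -1.\<close>

lemma degree_reduced_indep_poly_pos:
  assumes "simple_graph V E" "\<forall>\<^sub>F m in sequentially. lexpow_roots V E m \<noteq> {}"
  shows "degree (reduced_indep_poly V E) > 0"
proof (rule ccontr)
  define F where "F = reduced_indep_poly V E"
  assume "\<not> degree (reduced_indep_poly V E) > 0"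
  moreover have "coeff F 0 = 0"
    using assms by (simp add: F_def coeff_reduced_indep_poly simple_graph_def)
  ultimately have F0: "F = 0"
    by (metis F_def degree_0_id gr0I of_nat_0 pCons_0_0 coeff_pCons_0 degree_eq_zeroE)
  have "(poly F ^^ Suc m) z = 0" for m z
    by (simp add: F0)
  then have "lexpow_roots V E (Suc m) = {}" for m
    unfolding lexpow_roots_eq[OF assms(1)] F_def[symmetric] by simp
  moreover have "\<forall>\<^sub>F m in sequentially. lexpow_roots V E (Suc m) \<noteq> {}"
    using assms(2) by (subst eventually_sequentially_Suc)
  ultimately show False
    by simp
qed

lemma indep_count_1:
  assumes "simple_graph V E"
  shows "indep_count V E 1 = card V"
proof -
  have "{S. independent_set V E S \<and> card S = 1} = (\<lambda>x. {x}) ` V"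
    using assms by (auto simp: simple_graph_def independent_set_def card_1_singleton_iff)
  then show ?thesis
    by (simp add: indep_count_def card_image)
qed

text \<open>Here the independence polynomial is \<open>(1 + z) ^ card V\<close>, so -1 is its own
  only preimage under the reduced polynomial.\<close>

lemma lexpow_roots_edgeless:
  assumes G: "simple_graph V E" and V: "V \<noteq> {}" "independent_set V E V"
  shows "lexpow_roots V E m = {-1}"
proof (induction m)
  case 0
  show ?case
    by (simp add: lexpow_roots_0[OF G])
next
  case (Suc m)
  have fin: "finite V"
    using G by (simp add: simple_graph_def)
  have "{S. independent_set V E S} = Pow V"
    using V(2) by (auto simp: independent_set_def)
  then have "indep_poly V E z = (1 + z) ^ card V" for z
    using prod_add[OF fin, of "\<lambda>_. z" "\<lambda>_. 1"] by (simp add: indep_poly_def add.commute)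
  then have "poly (reduced_indep_poly V E) z = -1 \<longleftrightarrow> z = -1" for z
    using fin V(1) by (simp add: poly_reduced_indep_poly add_eq_0_iff card_gt_0_iff)
  then show ?case
    by (simp add: lexpow_roots_Suc[OF G] Suc)
qed

subsection \<open>The segment\<close>

text \<open>A root of a monic equation with integer coefficients is an algebraic integer, and a
  rational one is an integer.\<close>

lemma integer_if_rational_and_power:
  fixes k :: complex
  assumes "k \<in> \<rat>" "k ^ e \<in> \<int>" "e > 0"
  shows "k \<in> \<int>"
proof -
  have "algebraic_int k"
    by (rule algebraic_int_root[of "k ^ e" "monom 1 e"])
      (use assms in \<open>auto simp: poly_monom degree_monom_eq intro: int_imp_algebraic_int\<close>)
  then show ?thesis
    using assms(1) by (rule rational_algebraic_int_is_int)
qed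

text \<open>Eliminating \<open>t\<close> and then \<open>m\<close>, and cancelling \<open>m\<close>
  and \<open>n\<close>, yields \<open>7 * (k * n) + 2 * k \<le> 30 * n\<close>, which fails for
  \<open>k \<ge> 5\<close>.\<close>

lemma goodman_bound:
  fixes n m t k :: real
  assumes "4 * m\<^sup>2 - n\<^sup>2 * m \<le> 3 * n * t" and m: "12 * m = k * (n - 1) * n"
    and t: "30 * t = k * (n - 4) * m" and pos: "n > 1" "k > 0"
  shows "k < 5"
proof -
  have "m > 0"
    using m pos by (metis diff_gt_0_iff_gt less_trans mult_pos_pos zero_less_mult_pos zero_less_numeral zero_less_one)
  have "30 * (4 * m\<^sup>2 - n\<^sup>2 * m) \<le> 3 * n * (30 * t)"
    using assms(1) by simp
  then have "m * (30 * (4 * m - n\<^sup>2)) \<le> m * (3 * n * (k * (n - 4)))"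
    unfolding t by (simp add: algebra_simps power2_eq_square)
  then have "30 * (4 * m - n\<^sup>2) \<le> 3 * n * (k * (n - 4))"
    using \<open>m > 0\<close> by (rule mult_left_le_imp_le)
  then have "n * (10 * (k * (n - 1)) - 30 * n) \<le> n * (3 * (k * (n - 4)))"
    using m by (simp add: algebra_simps power2_eq_square)
  then have "10 * (k * (n - 1)) - 30 * n \<le> 3 * (k * (n - 4))"
    by (rule mult_left_le_imp_le) (use pos in simp)
  then have "7 * (k * n) + 2 * k \<le> 30 * n"
    by (simp add: algebra_simps)
  moreover have "5 * n \<le> k * n" if "5 \<le> k"
    using that pos by (intro mult_right_mono) auto
  ultimately show ?thesis
    using pos by linarith
qed

theorem theoremB:
  fixes V :: "'a set" and E :: "'a \<Rightarrow> 'a \<Rightarrow> bool" and J :: "complex set"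
  assumes "simple_graph V E"
    and "independence_attractor V E J"
    and "\<exists>a b. a \<noteq> b \<and> J = closed_segment a b"
  shows "\<exists>k::nat \<in> {1..4}. J = closed_segment (- (4 / of_nat k)) 0"
proof -
  define F where "F = reduced_indep_poly V E"
  define R where "R = lexpow_roots V E"
  define n d where "n = card V" and "d = degree F"
  have fin: "finite V"
    using assms(1) by (simp add: simple_graph_def)
  have J: "compact J" "J \<noteq> {}" "(\<lambda>m. hausdorff_dist (R m) J) \<longlonglongrightarrow> 0"
    and ne: "\<forall>\<^sub>F m in sequentially. R m \<noteq> {}"
    using assms(2) by (simp_all add: independence_attractor_def R_def)
  have d: "d > 0"
    unfolding d_def F_def using ne[unfolded R_def] by (rule degree_reduced_indep_poly_pos[OF assms(1)])
  have finR: "finite (R m)" for m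
    unfolding R_def using d by (intro finite_lexpow_roots assms(1)) (simp add: d_def F_def)
  have inv: "poly F z \<in> J \<longleftrightarrow> z \<in> J" for z
    using d by (intro hausdorff_limit_invariant[OF finR ne J])
      (simp_all add: R_def F_def d_def lexpow_roots_Suc[OF assms(1)])
  have coeff: "coeff F j = (if j = 0 then 0 else of_nat (indep_count V E j))" for j
    unfolding F_def by (rule coeff_reduced_indep_poly[OF fin])
  have c1: "coeff F 1 = of_nat n"
    using coeff[of 1] indep_count_1[OF assms(1)] by (simp add: n_def)
  obtain a b where ab: "a \<noteq> b" "J = closed_segment a b"
    using assms(3) by blast
  \<comment> \<open>Degree \<open>n\<close> would make all of \<open>V\<close> independent; the
    limit would then lie in \<open>{-1}\<close>, but a segment has two distinct endpoints.\<close>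
  have "d \<noteq> n"
  proof
    assume "d = n"
    then have "coeff F n \<noteq> 0"
      using d by (auto simp: d_def)
    then have "card {S. independent_set V E S \<and> card S = n} \<noteq> 0"
      by (simp add: coeff indep_count_def split: if_splits)
    then have "{S. independent_set V E S \<and> card S = n} \<noteq> {}"
      by (metis card.empty)
    then obtain S where "independent_set V E S" "card S = card V"
      by (auto simp: n_def)
    then have "independent_set V E V"
      using card_subset_eq[OF fin, of S] by (auto simp: independent_set_def)
    moreover have "V \<noteq> {}"
      using d \<open>d = n\<close> by (auto simp: n_def)
    ultimately have R: "R m = {-1}" for m
      unfolding R_def using assms(1) by (intro lexpow_roots_edgeless)
    have "z = -1" if z: "z \<in> J" for z
    proof -
      obtain w where "\<forall>\<^sub>F m in sequentially. w m \<in> R m" "w \<longlonglongrightarrow> z"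
        using hausdorff_limit_approx[OF finR ne J(1,3) z] by metis
      then have "w \<longlonglongrightarrow> -1"
        unfolding R by (intro tendsto_eventually) simp
      then show ?thesis
        using \<open>w \<longlonglongrightarrow> z\<close> LIMSEQ_unique by blast
    qed
    then show False
      using ab by (metis ends_in_segment)
  qed
  have F': "poly (pderiv F) 0 = of_nat n"
    using c1 by (simp add: poly_0_coeff_0 coeff_pderiv)
  have F0: "poly F 0 = 0"
    by (simp add: poly_0_coeff_0 coeff)
  have "smult (of_nat d ^ 2) ((F - [:a:]) * (F - [:b:])) = [:-a, 1:] * [:-b, 1:] * (pderiv F)\<^sup>2"
    unfolding d_def using segment_invariant_ode[OF ab(1), of F] inv d by (simp only: ab(2) d_def)
  then have "poly (smult (of_nat d ^ 2) ((F - [:a:]) * (F - [:b:]))) 0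
      = poly ([:-a, 1:] * [:-b, 1:] * (pderiv F)\<^sup>2) 0"
    by (rule arg_cong)
  then have "(of_nat d)\<^sup>2 * (a * b) = (of_nat n)\<^sup>2 * (a * b)"
    by (simp add: F' F0 algebra_simps del: mult_pCons_left mult_pCons_right)
  moreover have "(of_nat d)\<^sup>2 \<noteq> ((of_nat n)\<^sup>2 :: complex)"
    using \<open>d \<noteq> n\<close> by (metis of_nat_eq_iff of_nat_power power2_eq_imp_eq zero_le)
  ultimately have "a = 0 \<or> b = 0"
    by simp
  \<comment> \<open>From here on \<open>a\<close> denotes the nonzero endpoint.\<close>
  then obtain a where a: "a \<noteq> 0" "J = closed_segment a 0"
    using ab closed_segment_commute by metis
  have "smult (of_nat d ^ 2) ((F - [:a:]) * F) = [:-a, 1:] * [:0, 1:] * (pderiv F)\<^sup>2"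
    using segment_invariant_ode[OF a(1), of F] inv d by (simp add: a(2) d_def)
  moreover have "pderiv F \<noteq> 0"
    using d by (simp add: d_def pderiv_eq_0_iff)
  ultimately have ode: "smult (2 * of_nat d ^ 2) F - [:a * of_nat d ^ 2:]
      = [:-a, 2:] * pderiv F + smult 2 ([:0, -a, 1:] * pderiv (pderiv F))"
    by (rule chebyshev_ode_linear)
  have nd: "n = d\<^sup>2"
    using chebyshev_ode_coeffs(1)[OF ode a(1)] coeff[of 0] c1 by (metis of_nat_eq_iff of_nat_power)
  then have d2: "d \<ge> 2"
    using d \<open>d \<noteq> n\<close> by (cases "d = 1") auto
  then have "2 * 2 \<le> d * d"
    by (intro mult_mono) auto
  then have n4: "n \<ge> 4"
    by (simp add: nd power2_eq_square)
  \<comment> \<open>So far \<open>k\<close> is just a nonzero complex number; integrality and sign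
    follow from the coefficients.\<close>
  define k where "k = - 4 / a"
  have k: "k * - a = 4" "k \<noteq> 0"
    using a(1) by (simp_all add: k_def)
  have rec: "k * (of_nat d ^ 2 - of_nat j ^ 2) * coeff F j
      = 2 * of_nat (j + 1) * of_nat (2 * j + 1) * coeff F (Suc j)" if "j \<ge> 1" for j
  proof -
    have "2 * (k * (of_nat d ^ 2 - of_nat j ^ 2) * coeff F j)
        = k * (2 * (of_nat d ^ 2 - of_nat j ^ 2) * coeff F j)"
      by (simp add: algebra_simps)
    also have "\<dots> = k * - a * (of_nat (j + 1) * of_nat (2 * j + 1) * coeff F (Suc j))"
      using chebyshev_ode_coeffs(2)[OF ode a(1) _ that] coeff[of 0] by (simp add: mult.assoc)
    also have "\<dots> = 2 * (2 * of_nat (j + 1) * of_nat (2 * j + 1) * coeff F (Suc j))"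
      unfolding k(1) by (simp add: algebra_simps)
    finally show ?thesis
      by (metis mult_left_cancel zero_neq_numeral)
  qed
  have dn: "of_nat d ^ 2 = (of_nat n :: complex)"
    by (simp add: nd)
  \<comment> \<open>The recurrence at \<open>j = 1\<close> and below at \<open>j = 2\<close>: the
    constants are \<open>2 * 2 * 3\<close> and \<open>2 * 3 * 5\<close>.\<close>
  have "12 * coeff F 2 = k * ((of_nat n - 1) * of_nat n)"
    using rec[of 1, symmetric, unfolded dn] c1 by (simp add: numeral_2_eq_2 mult.assoc)
  then have c2: "12 * of_nat (indep_count V E 2) = k * of_nat ((n - 1) * n)"
    using n4 by (simp add: coeff of_nat_diff)
  have "30 * coeff F 3 = k * ((of_nat n - 4) * coeff F 2)"
    using rec[of 2, symmetric, unfolded dn] by (simp add: numeral_3_eq_3 numeral_2_eq_2 mult.assoc)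
  then have c3: "30 * of_nat (indep_count V E 3) = k * of_nat ((n - 4) * indep_count V E 2)"
    using n4 by (simp add: coeff of_nat_diff)
  \<comment> \<open>At \<open>j = d\<close> the binomial coefficient is 1, so the leading
    coefficient, a count, is a power of \<open>k\<close>.\<close>
  have "of_nat d * coeff F d = k ^ (d - 1) * of_nat d * of_nat ((d + d - 1) choose (2 * d - 1))"
    using rec d c1 by (intro chebyshev_recurrence) (simp_all add: nd)
  then have "k ^ (d - 1) = coeff F d"
    using d by (simp add: mult_2)
  then have "k ^ (d - 1) \<in> \<int>"
    by (simp add: coeff)
  moreover have "k = 12 * of_nat (indep_count V E 2) / of_nat ((n - 1) * n)"
    using n4 unfolding c2 by simp
  then have "k \<in> \<rat>"
    by (metis Rats_divide Rats_mult Rats_number_of Rats_of_nat)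
  ultimately have "k \<in> \<int>"
    using d2 by (intro integer_if_rational_and_power[of k "d - 1"]) auto
  then obtain i where i: "k = of_int i"
    by (auto elim: Ints_cases)
  have "of_int (12 * int (indep_count V E 2)) = (of_int (i * int ((n - 1) * n)) :: complex)"
    using c2 by (simp add: i)
  then have c2i: "12 * int (indep_count V E 2) = i * int ((n - 1) * n)"
    by (simp only: of_int_eq_iff)
  \<comment> \<open>The sign of \<open>i\<close> comes from the count of independent pairs; zero is
    excluded by \<open>k \<noteq> 0\<close>.\<close>
  have "0 \<le> i * int ((n - 1) * n)"
    unfolding c2i[symmetric] by simp
  moreover have "int ((n - 1) * n) > 0"
    using n4 by simp
  ultimately have "i \<ge> 0"
    by (metis mult_neg_pos not_le)
  then obtain K where K: "i = int K"
    using nonneg_int_cases by blast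
  then have kK: "k = of_nat K" and "K > 0"
    using i k(2) by auto
  have "of_nat (12 * indep_count V E 2) = (of_nat (K * (n - 1) * n) :: complex)"
    using c2 by (simp add: kK mult.assoc)
  then have c2n: "12 * indep_count V E 2 = K * (n - 1) * n"
    by (simp only: of_nat_eq_iff)
  have "of_nat (30 * indep_count V E 3) = (of_nat (K * (n - 4) * indep_count V E 2) :: complex)"
    using c3 by (simp add: kK mult.assoc)
  then have c3n: "30 * indep_count V E 3 = K * (n - 4) * indep_count V E 2"
    by (simp only: of_nat_eq_iff)
  have "real K < 5"
  proof (rule goodman_bound)
    show "4 * (real (indep_count V E 2))\<^sup>2 - (real n)\<^sup>2 * real (indep_count V E 2)
        \<le> 3 * real n * real (indep_count V E 3)"
      unfolding n_def by (rule goodman_indep_count[OF assms(1)])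
    have "real (12 * indep_count V E 2) = real (K * (n - 1) * n)"
      by (simp only: c2n)
    then show "12 * real (indep_count V E 2) = real K * (real n - 1) * real n"
      using n4 by (simp add: of_nat_diff)
    have "real (30 * indep_count V E 3) = real (K * (n - 4) * indep_count V E 2)"
      by (simp only: c3n)
    then show "30 * real (indep_count V E 3) = real K * (real n - 4) * real (indep_count V E 2)"
      using n4 by (simp add: of_nat_diff)
  qed (use n4 \<open>K > 0\<close> in auto)
  then have "K \<in> {1..4}"
    using \<open>K > 0\<close> by auto
  moreover have "a = - (4 / of_nat K)"
    using a(1) unfolding kK[symmetric] k_def by simp
  ultimately show ?thesis
    using a(2) by blast
qed

end
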